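(* Let $R$ be an associative ring with a nonzero ideal $I$ and a semiprime ideal $T$ such that $T\subsetneq I$, and let $d:R\to R$ be a derivation of $R$. If $\mathrm{char}(R/T)\neq 2$ and $\overline{[[d(x),x],x]}\in Z(R/T)$ for all $x\in I$, then $d$ is $T$-commuting on $I$, i.e. $[d(x),x]\in T$ for all $x\in I$.
   Context: $[x,y]=xy-yx$ for $x,y\in R$; $\overline{a}=a+T$ denotes the class of $a\in R$ in the quotient ring $R/T$, $Z(R/T)$ is the center of $R/T$, and $\mathrm{char}(R/T)$ is its characteristic. An ideal $T$ of $R$ is semiprime if, for $a\in R$, $aRa\subseteq T$ implies $a\in T$. A derivation of $R$ is an additive map $d:R\to R$ with $d(xy)=d(x)y+xd(y)$ for all $x,y\in R$. For a nonempty subset $K\subseteq R$, a derivation $d$ is called $T$-commuting on $K$ if $[d(x),x]\in T$ for all $x\in K$. *)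

theory Defs
  imports Complex_Main "HOL-Library.Set_Algebras"
begin

text \<open>The type class \<open>ring\<close> is that of associative rings, not necessarily with a unit,
  and all notions below are the non-unital ones. Ideals are two-sided.\<close>

definition two_sided_ideal :: "'a::ring set \<Rightarrow> bool" where
  "two_sided_ideal I \<longleftrightarrow> 0 \<in> I \<and> (\<forall>x\<in>I. \<forall>y\<in>I. x - y \<in> I)
     \<and> (\<forall>r. \<forall>x\<in>I. r * x \<in> I \<and> x * r \<in> I)"

definition semiprime_ideal :: "'a::ring set \<Rightarrow> bool" where
  "semiprime_ideal T \<longleftrightarrow> two_sided_ideal T \<and> (\<forall>a. (\<forall>r. a * r * a \<in> T) \<longrightarrow> a \<in> T)"

definition commutator :: "'a::ring \<Rightarrow> 'a \<Rightarrow> 'a" where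
  "commutator x y = x * y - y * x"

definition derivation :: "('a::ring \<Rightarrow> 'a) \<Rightarrow> bool" where
  "derivation d \<longleftrightarrow> additive d \<and> (\<forall>x y. d (x * y) = d x * y + x * d y)"

definition T_commuting_on :: "'a::ring set \<Rightarrow> ('a \<Rightarrow> 'a) \<Rightarrow> 'a set \<Rightarrow> bool" where
  "T_commuting_on T d K \<longleftrightarrow> (\<forall>x\<in>K. commutator (d x) x \<in> T)"


text \<open>The quotient ring \<open>R/T\<close>: its elements are the cosets \<open>a +o T\<close>, its zero is \<open>T\<close>, and
  the sum of two cosets is their elementwise sum \<open>A + B\<close> from Set_Algebras. The elementwise
  product of two cosets need not be a full coset, hence the separate definition of the product
  as the union of all \<open>a * b + T\<close> (which, for an ideal \<open>T\<close>, all coincide).\<close>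

definition quot_carrier :: "'a::ring set \<Rightarrow> 'a set set" where
  "quot_carrier T = range (\<lambda>a. a +o T)"

definition quot_mult :: "'a::ring set \<Rightarrow> 'a set \<Rightarrow> 'a set \<Rightarrow> 'a set" where
  "quot_mult T A B = (\<Union>a\<in>A. \<Union>b\<in>B. (a * b) +o T)"

definition quot_center :: "'a::ring set \<Rightarrow> 'a set set" where
  "quot_center T =
     {A \<in> quot_carrier T. \<forall>B \<in> quot_carrier T. quot_mult T A B = quot_mult T B A}"

definition quot_nsum :: "'a::ring set \<Rightarrow> nat \<Rightarrow> 'a set \<Rightarrow> 'a set" where
  "quot_nsum T n A = (((+) A) ^^ n) T"

text \<open>Without a unit, the characteristic is the least \<open>n > 0\<close> annihilating every element,
  and \<open>0\<close> if there is none.\<close>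

definition quot_char :: "'a::ring set \<Rightarrow> nat" where
  "quot_char T =
     (if \<exists>n>0. \<forall>A \<in> quot_carrier T. quot_nsum T n A = T
      then LEAST n. n > 0 \<and> (\<forall>A \<in> quot_carrier T. quot_nsum T n A = T)
      else 0)"


lemma quot_add_coset:
  assumes "two_sided_ideal T"
  shows "(a +o T) + (b +o T) = (a + b) +o T"
proof -
  have z: "0 \<in> T" and d: "\<And>x y. x \<in> T \<Longrightarrow> y \<in> T \<Longrightarrow> x - y \<in> T"
    using assms by (auto simp: two_sided_ideal_def)
  have p: "x + y \<in> T" if "x \<in> T" "y \<in> T" for x y
    using d[OF that(1) d[OF z that(2)]] by simp
  have "T + T = T"
  proof
    show "T + T \<subseteq> T" using p by (auto simp: set_plus_def)
    show "T \<subseteq> T + T" using set_plus_intro[OF _ z, of _ T] by (metis add_0_right subsetI)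
  qed
  then show ?thesis by (simp only: set_plus_rearrange)
qed

lemma quot_mult_coset:
  assumes "two_sided_ideal T"
  shows "quot_mult T (a +o T) (b +o T) = (a * b) +o T"
proof -
  have z: "0 \<in> T" and d: "\<And>x y. x \<in> T \<Longrightarrow> y \<in> T \<Longrightarrow> x - y \<in> T"
    and m: "\<And>r x. x \<in> T \<Longrightarrow> r * x \<in> T \<and> x * r \<in> T"
    using assms by (auto simp: two_sided_ideal_def)
  have p: "x + y \<in> T" if "x \<in> T" "y \<in> T" for x y
    using d[OF that(1) d[OF z that(2)]] by simp
  have st: "((a + s) * (b + t)) +o T = (a * b) +o T" if "s \<in> T" "t \<in> T" for s t
  proof -
    define u where "u = a * t + (s * b + s * t)"
    have u: "u \<in> T" unfolding u_def by (intro p) (simp_all add: m that)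
    have e: "(a + s) * (b + t) = a * b + u" by (simp add: u_def algebra_simps)
    have "u +o T = T"
    proof
      show "u +o T \<subseteq> T" using u p by (auto simp: elt_set_plus_def)
      show "T \<subseteq> u +o T"
      proof
        fix x assume "x \<in> T"
        then show "x \<in> u +o T"
          using set_plus_intro2[OF d[OF _ u], of x u] by simp
      qed
    qed
    then show ?thesis unfolding e by (simp flip: set_plus_rearrange2)
  qed
  have e: "(x * y) +o T = (a * b) +o T" if xy: "x \<in> a +o T" "y \<in> b +o T" for x y
  proof -
    obtain s t where "s \<in> T" "t \<in> T" "x = a + s" "y = b + t"
      using xy unfolding elt_set_plus_def by blast
    then show ?thesis using st by simp
  qed
  have ne: "a +o T \<noteq> {}" "b +o T \<noteq> {}" using z by (auto simp: elt_set_plus_def)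
  have "quot_mult T (a +o T) (b +o T) = (\<Union>x\<in>a +o T. \<Union>y\<in>b +o T. (a * b) +o T)"
    unfolding quot_mult_def using e by (intro SUP_cong) auto
  then show ?thesis using ne by simp
qed

lemma coset_in_quot_center_iff:
  assumes "two_sided_ideal T"
  shows "a +o T \<in> quot_center T \<longleftrightarrow> (\<forall>b. (a * b) +o T = (b * a) +o T)"
  by (auto simp: quot_center_def quot_carrier_def quot_mult_coset[OF assms])

end

theory Submission
  imports Defs
begin

text \<open>Modulo \<open>T\<close>, the ring splits along \<open>J = {a. 2a \<in> T}\<close>: both \<open>J\<close> and its annihilator
  \<open>K = {a. a J \<subseteq> T}\<close> are semiprime, \<open>R/J\<close> is 2-torsion free, \<open>R/K\<close> has characteristic 2,
  and \<open>J \<inter> K = T\<close>. Write \<open>u\<^sub>x = [d(x), x]\<close> and \<open>f\<^sub>x = [u\<^sub>x, x]\<close>.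

  In the 2-torsion free case, the linearisations of \<open>f\<^sub>x\<close> at \<open>x\<^sup>2\<close>, \<open>d(x) x\<close> and \<open>d(x) x\<^sup>2\<close> give
  \<open>f\<^sub>x = 0\<close>; those at \<open>y x\<close> and \<open>x y\<close> then give \<open>2 d(x) [y,x] u\<^sub>x + 3 u\<^sub>x y u\<^sub>x = 0\<close>, its mirror
  image and \<open>u\<^sub>x [y,x] u\<^sub>x = 0\<close>, which together yield \<open>4 u\<^sub>x y u\<^sub>x z u\<^sub>x = 0\<close>.

  In characteristic 2, linearising yields \<open>[[[y,x],x],x] u\<^sub>x = 0\<close>. If \<open>v = [a,x]\<close> is central and
  \<open>s = a x\<close>, then \<open>[x,s] = - v x\<close>, so this identity for \<open>s\<close> and for \<open>s + x\<close>, with \<open>y = x\<close>, makes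
  \<open>v\<^sup>3 x\<close> annihilate \<open>u\<^bsub>s+x\<^esub> - u\<^sub>s = u\<^sub>x + d(v) x + v d(x)\<close>. Taking \<open>a = u\<^sub>x\<close> and bracketing with \<open>x\<close>
  and \<open>u\<^sub>x\<close> gives \<open>f\<^sub>x = 0\<close>. Then \<open>[[y,x],x] u\<^sub>x = 0\<close>, so \<open>x\<^sup>2\<close> is central on the support of \<open>u\<^sub>x\<close>,
  whence \<open>u\<^sub>x = d(x\<^sup>2)\<close> is central, and the same argument with \<open>a = d(x)\<close> gives \<open>u\<^sub>x = 0\<close>. Since
  \<open>d\<close> need not preserve the ideal, one also needs that \<open>d(t)\<close> annihilates \<open>[R, I]\<close> for
  \<open>t \<in> T \<inter> I\<close>.\<close>

notation commutator ("\<langle>_, _\<rangle>")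

section \<open>Arithmetic modulo a semiprime ideal\<close>

locale semiprime =
  fixes T :: "'a::ring set"
  assumes semiprime_ideal: "semiprime_ideal T"
begin

lemma ideal: "two_sided_ideal T"
  using semiprime_ideal by (simp add: semiprime_ideal_def)

lemma zero_mem [simp]: "0 \<in> T"
  and diff_mem [simp]: "a \<in> T \<Longrightarrow> b \<in> T \<Longrightarrow> a - b \<in> T"
  and mult_left_mem [simp]: "a \<in> T \<Longrightarrow> r * a \<in> T"
  and mult_right_mem [simp]: "a \<in> T \<Longrightarrow> a * r \<in> T"
  using ideal by (simp_all add: two_sided_ideal_def)

lemma uminus_mem [simp]: "- a \<in> T \<longleftrightarrow> a \<in> T"
  using diff_mem[of 0 a] diff_mem[of 0 "- a"] by auto

lemma add_mem [simp]: "a \<in> T \<Longrightarrow> b \<in> T \<Longrightarrow> a + b \<in> T"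
  using diff_mem[of a "- b"] by simp

lemma commutator_mem [simp]: "a \<in> T \<Longrightarrow> \<langle>a, r\<rangle> \<in> T" "a \<in> T \<Longrightarrow> \<langle>r, a\<rangle> \<in> T"
  by (simp_all add: commutator_def)

lemma semiprimeD: "(\<And>r. a * r * a \<in> T) \<Longrightarrow> a \<in> T"
  using semiprime_ideal unfolding semiprime_ideal_def by blast

lemma coset_eq_iff: "a +o T = b +o T \<longleftrightarrow> a - b \<in> T"
proof
  assume "a +o T = b +o T"
  moreover have "a \<in> a +o T" using set_plus_intro2[OF zero_mem, of a] by simp
  ultimately show "a - b \<in> T" by (auto simp: elt_set_plus_def)
next
  assume *: "a - b \<in> T"
  have "a + t = b + ((a - b) + t)" "b + t = a + (t - (a - b))" for t by simp_all
  then show "a +o T = b +o T" using * unfolding elt_set_plus_def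
    by (blast intro: add_mem diff_mem)
qed

definition central :: "'a \<Rightarrow> bool" where
  "central a \<longleftrightarrow> (\<forall>r. \<langle>a, r\<rangle> \<in> T)"

lemma centralD [simp]: "central a \<Longrightarrow> \<langle>a, r\<rangle> \<in> T"
  by (simp add: central_def)

lemma central_add [simp]: "central a \<Longrightarrow> central b \<Longrightarrow> central (a + b)"
proof -
  have "\<langle>a + b, r\<rangle> = \<langle>a, r\<rangle> + \<langle>b, r\<rangle>" for r by (simp add: commutator_def algebra_simps)
  then show "central a \<Longrightarrow> central b \<Longrightarrow> central (a + b)" by (simp add: central_def)
qed

lemma central_diff [simp]: "central a \<Longrightarrow> central b \<Longrightarrow> central (a - b)"
proof -
  have "\<langle>a - b, r\<rangle> = \<langle>a, r\<rangle> - \<langle>b, r\<rangle>" for r by (simp add: commutator_def algebra_simps)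
  then show "central a \<Longrightarrow> central b \<Longrightarrow> central (a - b)" by (simp add: central_def)
qed

lemma central_mult [simp]: "central a \<Longrightarrow> central b \<Longrightarrow> central (a * b)"
proof -
  have "\<langle>a * b, r\<rangle> = a * \<langle>b, r\<rangle> + \<langle>a, r\<rangle> * b" for r by (simp add: commutator_def algebra_simps)
  then show "central a \<Longrightarrow> central b \<Longrightarrow> central (a * b)" by (simp add: central_def)
qed

lemma mem_central: "a \<in> T \<Longrightarrow> central a"
  by (simp add: central_def)

lemma central_cong:
  assumes "central b" "a - b \<in> T"
  shows "central a"
  using central_add[OF assms(1) mem_central[OF assms(2)]] by simp

lemma central_commute_mem:
  assumes "central k" "a * k \<in> T"
  shows "k * a \<in> T"
proof -
  have "k * a = \<langle>k, a\<rangle> + a * k" by (simp add: commutator_def)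
  then show ?thesis using assms by simp
qed

text \<open>Moving \<open>k\<close> into the bracket costs only \<open>[k, b] a\<close>. Repeated
  use carries an annihilation by \<open>k\<close> over to iterated brackets.\<close>

lemma central_mult_commutator:
  assumes "central k" "k * a \<in> T"
  shows "k * \<langle>a, b\<rangle> \<in> T"
proof -
  have "k * \<langle>a, b\<rangle> = \<langle>k * a, b\<rangle> - \<langle>k, b\<rangle> * a" by (simp add: commutator_def algebra_simps)
  then show ?thesis using assms by simp
qed

text \<open>Modulo \<open>T\<close>, \<open>a r a = r a^2\<close>: a semiprime quotient has no
  nonzero central nilpotents.\<close>

lemma central_square:
  assumes "central a" "a * a \<in> T"
  shows "a \<in> T"
proof (rule semiprimeD)
  fix r
  have "a * r * a = \<langle>a, r\<rangle> * a + r * (a * a)" by (simp add: commutator_def algebra_simps)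
  then show "a * r * a \<in> T" using assms by simp
qed

end

section \<open>Derivations with central double commutators on \<open>I\<close>\<close>

locale centralising = semiprime T for T :: "'a::ring set" +
  fixes I :: "'a set" and d :: "'a \<Rightarrow> 'a"
  assumes ideal_I: "two_sided_ideal I"
    and derivation: "derivation d"
    and centralising: "x \<in> I \<Longrightarrow> central \<langle>\<langle>d x, x\<rangle>, x\<rangle>"
begin

lemma diff_mem_I [simp]: "a \<in> I \<Longrightarrow> b \<in> I \<Longrightarrow> a - b \<in> I"
  and mult_left_mem_I [simp]: "a \<in> I \<Longrightarrow> r * a \<in> I"
  and mult_right_mem_I [simp]: "a \<in> I \<Longrightarrow> a * r \<in> I"
  using ideal_I by (simp_all add: two_sided_ideal_def)

lemma add_mem_I [simp]: "a \<in> I \<Longrightarrow> b \<in> I \<Longrightarrow> a + b \<in> I"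
proof -
  assume ab: "a \<in> I" "b \<in> I"
  have "a - (0 - b) \<in> I"
    using ab ideal_I by (intro diff_mem_I) (auto simp: two_sided_ideal_def)
  then show "a + b \<in> I" by simp
qed

lemma commutator_mem_I [simp]: "a \<in> I \<Longrightarrow> \<langle>a, r\<rangle> \<in> I" "a \<in> I \<Longrightarrow> \<langle>r, a\<rangle> \<in> I"
  by (simp_all add: commutator_def)

text \<open>In \<open>(a r a) s (a r a)\<close> everything between the outer factors
  \<open>a\<close> lies in \<open>I\<close>, since it contains \<open>a\<close> again.\<close>

lemma semiprime_I:
  assumes "a \<in> I" "\<And>y. y \<in> I \<Longrightarrow> a * y * a \<in> T"
  shows "a \<in> T"
proof (rule semiprimeD, rule semiprimeD)
  fix r s
  have "a * (r * a * s * a * r) * a \<in> T" using assms by simp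
  then show "a * r * a * s * (a * r * a) \<in> T" by (simp add: mult.assoc)
qed

lemma d_mult: "d (a * b) = d a * b + a * d b"
  using derivation by (simp add: derivation_def)

lemma d_add: "d (a + b) = d a + d b"
  using derivation by (simp add: derivation_def additive_def)

lemma d_diff: "d (a - b) = d a - d b"
  using derivation by (simp add: derivation_def additive.diff)

lemmas d_simps = d_mult d_add d_diff

end

section \<open>The 2-torsion free case\<close>

locale centralising_torsion_free = centralising T I d
  for T I :: "'a::ring set" and d +
  assumes torsion_free: "a + a \<in> T \<Longrightarrow> a \<in> T"
begin

text \<open>The part of \<open>[[d (x + y), x + y], x + y]\<close> that is linear in
  \<open>y\<close>.\<close>

definition polar :: "'a \<Rightarrow> 'a \<Rightarrow> 'a" where
  "polar x y = \<langle>\<langle>d y, x\<rangle>, x\<rangle> + \<langle>\<langle>d x, y\<rangle>, x\<rangle> + \<langle>\<langle>d x, x\<rangle>, y\<rangle>"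

text \<open>Even degrees in \<open>y\<close> cancel in the difference of the values at
  \<open>x + y\<close> and \<open>x - y\<close>; removing the cubic part leaves twice the linear
  one.\<close>

lemma polar_eq:
  "polar x y + polar x y
     = \<langle>\<langle>d (x + y), x + y\<rangle>, x + y\<rangle> - \<langle>\<langle>d (x - y), x - y\<rangle>, x - y\<rangle>
       - \<langle>\<langle>d y, y\<rangle>, y\<rangle> - \<langle>\<langle>d y, y\<rangle>, y\<rangle>"
  by (simp add: polar_def commutator_def d_simps algebra_simps)

lemma central_half: "central (a + a) \<Longrightarrow> central a"
proof -
  have "\<langle>a + a, r\<rangle> = \<langle>a, r\<rangle> + \<langle>a, r\<rangle>" for r by (simp add: commutator_def algebra_simps)
  then show "central (a + a) \<Longrightarrow> central a" unfolding central_def by (metis torsion_free)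
qed

lemma polar_central:
  assumes "x \<in> I" "y \<in> I"
  shows "central (polar x y)"
  by (rule central_half, unfold polar_eq) (use assms in \<open>simp add: centralising\<close>)

text \<open>\<open>d y\<close> survives only inside \<open>polar x y * x\<close>, so it disappears
  once that term is under control.\<close>

lemma polar_mult_right:
  "polar x (y * x) = polar x y * x + \<langle>\<langle>y, x\<rangle>, x\<rangle> * d x
     + (\<langle>y, x\<rangle> + \<langle>y, x\<rangle> + \<langle>y, x\<rangle>) * \<langle>d x, x\<rangle>
     + (y + y + y) * \<langle>\<langle>d x, x\<rangle>, x\<rangle>"
  by (simp add: polar_def commutator_def d_simps algebra_simps)

lemma polar_mult_left:
  "polar x (x * y) = x * polar x y + d x * \<langle>\<langle>y, x\<rangle>, x\<rangle>
     + \<langle>d x, x\<rangle> * (\<langle>y, x\<rangle> + \<langle>y, x\<rangle> + \<langle>y, x\<rangle>)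
     + \<langle>\<langle>d x, x\<rangle>, x\<rangle> * (y + y + y)"
  by (simp add: polar_def commutator_def d_simps algebra_simps)

text \<open>With \<open>f\<close> the double commutator, linearising in direction \<open>x^2\<close>
  makes \<open>3 f x\<close> central, and bracketing with \<open>[d x, x]\<close> gives
  \<open>3 f^2\<close> in \<open>T\<close>. The factor 3 stays because only 2-torsion is
  excluded.\<close>

lemma triple_mem:
  assumes x: "x \<in> I"
  shows "\<langle>\<langle>d x, x\<rangle>, x\<rangle> + \<langle>\<langle>d x, x\<rangle>, x\<rangle> + \<langle>\<langle>d x, x\<rangle>, x\<rangle> \<in> T"
proof -
  define f where "f = \<langle>\<langle>d x, x\<rangle>, x\<rangle>"
  define g where "g = f + f + f"
  have f: "central f" using x by (simp add: f_def centralising)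
  then have g: "central g" by (simp add: g_def)
  have "polar x (x * x) = (g * x + g * x) - (\<langle>f, x\<rangle> + \<langle>f, x\<rangle> + \<langle>f, x\<rangle>)"
    by (simp add: g_def f_def polar_def commutator_def d_simps algebra_simps)
  then have "g * x + g * x = polar x (x * x) + (\<langle>f, x\<rangle> + \<langle>f, x\<rangle> + \<langle>f, x\<rangle>)" by simp
  moreover have "central (polar x (x * x) + (\<langle>f, x\<rangle> + \<langle>f, x\<rangle> + \<langle>f, x\<rangle>))"
    using f x by (intro central_add polar_central mem_central) auto
  ultimately have "central (g * x)" by (metis central_half)
  moreover have "g * f = - \<langle>g * x, \<langle>d x, x\<rangle>\<rangle> + \<langle>g, \<langle>d x, x\<rangle>\<rangle> * x"
    by (simp add: f_def commutator_def algebra_simps)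
  ultimately have "g * f \<in> T" using g by simp
  then have "g * g \<in> T" by (simp add: g_def distrib_left)
  with g have "g \<in> T" by (rule central_square)
  then show ?thesis by (simp add: g_def f_def)
qed

lemma double_commutator_mem:
  assumes x: "x \<in> I"
  shows "\<langle>\<langle>d x, x\<rangle>, x\<rangle> \<in> T"
proof -
  define u where "u = \<langle>d x, x\<rangle>"
  define f where "f = \<langle>u, x\<rangle>"
  \<comment> \<open>This choice makes \<open>[y, x] = u x\<close>. As \<open>3 f\<close> is in
    \<open>T\<close>, bracketing \<open>polar x (y x)\<close> with \<open>x\<close> then leaves only
    \<open>f x u\<close>.\<close>
  define y where "y = d x * x"
  have f: "central f" using x by (simp add: f_def u_def centralising)
  have f3: "f + f + f \<in> T" using triple_mem[OF x] by (simp add: f_def u_def)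
  define p where "p = polar x y"
  define q where "q = polar x (y * x)"
  have pq: "central p" "central q" using x by (auto simp: p_def q_def y_def intro!: polar_central)
  have y_x: "\<langle>y, x\<rangle> = u * x" and y_xx: "\<langle>\<langle>y, x\<rangle>, x\<rangle> = f * x"
    by (simp_all add: y_def f_def u_def commutator_def algebra_simps)
  have q: "q = p * x + f * x * d x + (u * x + u * x + u * x) * u + (y + y + y) * f"
    unfolding q_def p_def polar_mult_right y_x[symmetric] y_xx[symmetric] by (simp add: u_def f_def)
  \<comment> \<open>Moving \<open>x\<close> to the left of \<open>d x\<close> and \<open>u\<close>
    gives a normal form; the variants with \<open>z\<close> act inside right-nested
    products.\<close>
  have Dx: "d x * x = u + x * d x" "d x * (x * z) = u * z + x * (d x * z)"
    and ux: "u * x = f + x * u" "u * (x * z) = f * z + x * (u * z)" for z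
    by (simp_all add: u_def f_def commutator_def algebra_simps)
  have "f * (x * u) = \<langle>q, x\<rangle> - \<langle>p, x\<rangle> * x - (f + f + f) * (x * u)
      - u * x * (f + f + f) - u * x * (f + f + f)
      - \<langle>f, x\<rangle> * (x * d x) - (y + y + y) * \<langle>f, x\<rangle>"
    by (simp add: q y_def commutator_def algebra_simps Dx ux)
  then have a: "f * (x * u) \<in> T" using f f3 pq by simp
  \<comment> \<open>Bracketing with \<open>x\<close> turns \<open>u\<close> into \<open>f\<close>;
    bracketing with \<open>u\<close> below turns \<open>x\<close> into \<open>- f\<close>, which
    leaves a power of \<open>f\<close>.\<close>
  have "f * \<langle>x * u, x\<rangle> \<in> T" using f a by (rule central_mult_commutator)
  moreover have "\<langle>x * u, x\<rangle> = x * f" by (simp add: f_def commutator_def algebra_simps)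
  ultimately have "f * (x * f) \<in> T" by simp
  then have "f * f * x \<in> T" using f central_commute_mem[of f "x * f"]
    by (metis mult.assoc central_commute_mem)
  then have "f * f * \<langle>x, u\<rangle> \<in> T" using f by (intro central_mult_commutator) auto
  moreover have "\<langle>x, u\<rangle> = - f" by (simp add: f_def commutator_def)
  ultimately have "f * f * f \<in> T" by simp
  then have "f * f * (f * f) \<in> T" using mult_right_mem[of "f * f * f" f] by (simp add: mult.assoc)
  then show ?thesis using f by (metis central_square central_mult f_def u_def)
qed

theorem commuting:
  assumes x: "x \<in> I"
  shows "\<langle>d x, x\<rangle> \<in> T"
proof -
  define u where "u = \<langle>d x, x\<rangle>"
  define D where "D = d x"
  have f: "\<langle>\<langle>d z, z\<rangle>, z\<rangle> \<in> T" if "z \<in> I" for z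
    using that by (rule double_commutator_mem)
  have ux: "\<langle>u, x\<rangle> \<in> T" and uI: "u \<in> I" using f x by (auto simp: u_def)
  have polar: "polar x y \<in> T" if "y \<in> I" for y
    by (rule torsion_free, unfold polar_eq) (use that x f in simp)
  have right: "\<langle>\<langle>y, x\<rangle>, x\<rangle> * D + (\<langle>y, x\<rangle> + \<langle>y, x\<rangle> + \<langle>y, x\<rangle>) * u \<in> T" if "y \<in> I" for y
  proof -
    have "\<langle>\<langle>y, x\<rangle>, x\<rangle> * D + (\<langle>y, x\<rangle> + \<langle>y, x\<rangle> + \<langle>y, x\<rangle>) * u
        = polar x (y * x) - polar x y * x - (y + y + y) * \<langle>u, x\<rangle>"
      unfolding polar_mult_right D_def u_def by simp
    then show ?thesis using polar that ux by simp
  qed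
  have left: "D * \<langle>\<langle>y, x\<rangle>, x\<rangle> + u * (\<langle>y, x\<rangle> + \<langle>y, x\<rangle> + \<langle>y, x\<rangle>) \<in> T" if "y \<in> I" for y
  proof -
    have "D * \<langle>\<langle>y, x\<rangle>, x\<rangle> + u * (\<langle>y, x\<rangle> + \<langle>y, x\<rangle> + \<langle>y, x\<rangle>)
        = polar x (x * y) - x * polar x y - \<langle>u, x\<rangle> * (y + y + y)"
      unfolding polar_mult_left D_def u_def by simp
    then show ?thesis using polar that ux by simp
  qed
  have Dx: "D * x = u + x * D" "D * (x * z) = u * z + x * (D * z)" for z
    by (simp_all add: u_def D_def commutator_def algebra_simps)
  \<comment> \<open>Replacing \<open>y\<close> by \<open>y D\<close> and subtracting the identity
    times \<open>D\<close> removes the double bracket, while \<open>[D, x] = u\<close> supplies new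
    factors \<open>u\<close>. \<open>R\<close> mirrors this.\<close>
  have L: "D * \<langle>y, x\<rangle> * u + D * \<langle>y, x\<rangle> * u + (u * y * u + u * y * u + u * y * u) \<in> T" (is "?L y \<in> T")
    if "y \<in> I" for y
  proof -
    have "?L y = (D * \<langle>\<langle>y * D, x\<rangle>, x\<rangle> + u * (\<langle>y * D, x\<rangle> + \<langle>y * D, x\<rangle> + \<langle>y * D, x\<rangle>))
        - (D * \<langle>\<langle>y, x\<rangle>, x\<rangle> + u * (\<langle>y, x\<rangle> + \<langle>y, x\<rangle> + \<langle>y, x\<rangle>)) * D - D * y * \<langle>u, x\<rangle>"
      by (simp add: commutator_def algebra_simps Dx)
    also have "\<dots> \<in> T" using left[of "y * D"] left[of y] that ux by simp
    finally show ?thesis .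
  qed
  have R: "u * \<langle>y, x\<rangle> * D + u * \<langle>y, x\<rangle> * D + (u * y * u + u * y * u + u * y * u) \<in> T" (is "?R y \<in> T")
    if "y \<in> I" for y
  proof -
    have "?R y = (\<langle>\<langle>D * y, x\<rangle>, x\<rangle> * D + (\<langle>D * y, x\<rangle> + \<langle>D * y, x\<rangle> + \<langle>D * y, x\<rangle>) * u)
        - D * (\<langle>\<langle>y, x\<rangle>, x\<rangle> * D + (\<langle>y, x\<rangle> + \<langle>y, x\<rangle> + \<langle>y, x\<rangle>) * u) - \<langle>u, x\<rangle> * y * D"
      by (simp add: commutator_def algebra_simps Dx)
    also have "\<dots> \<in> T" using right[of "D * y"] right[of y] that ux by simp
    finally show ?thesis .
  qed
  \<comment> \<open>Comparing \<open>L\<close> at \<open>x y\<close> with \<open>x\<close> times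
    \<open>L\<close> at \<open>y\<close> brings out \<open>D x - x D = u\<close> on the
    left.\<close>
  have C: "u * \<langle>y, x\<rangle> * u \<in> T" if "y \<in> I" for y
  proof (rule torsion_free)
    have "u * \<langle>y, x\<rangle> * u + u * \<langle>y, x\<rangle> * u
        = ?L (x * y) - x * ?L y - (\<langle>u, x\<rangle> + \<langle>u, x\<rangle> + \<langle>u, x\<rangle>) * y * u"
      by (simp add: commutator_def algebra_simps Dx)
    also have "\<dots> \<in> T" using L[of "x * y"] L[of y] that ux by simp
    finally show "u * \<langle>y, x\<rangle> * u + u * \<langle>y, x\<rangle> * u \<in> T" .
  qed
  have quartic: "u * y * u * z * u \<in> T" if "y \<in> I" "z \<in> I" for y z
  proof (rule torsion_free, rule torsion_free)
    let ?w = "u * y * u * z * u"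
    \<comment> \<open>\<open>[y D z, x]\<close> contains \<open>y u z\<close>, so subtracting
      \<open>2 ?v\<close> removes all terms with \<open>D\<close> and two of the six copies of
      \<open>?w\<close>.\<close>
    let ?v = "u * \<langle>y * D * z, x\<rangle> * u"
    have "?w + ?w + (?w + ?w) = ?R y * (z * u) - (?v + ?v) + u * y * ?L z"
      by (simp add: commutator_def algebra_simps Dx)
    also have "\<dots> \<in> T" using R[of y] C[of "y * D * z"] L[of z] that ux by simp
    finally show "?w + ?w + (?w + ?w) \<in> T" .
  qed
  have "u * y * u \<in> T" if "y \<in> I" for y
  proof (rule semiprime_I)
    show "u * y * u \<in> I" using uI by simp
    show "u * y * u * z * (u * y * u) \<in> T" if "z \<in> I" for z
    proof -
      have "u * y * u * z * u * (y * u) \<in> T" using quartic[OF \<open>y \<in> I\<close> that] by simp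
      then show ?thesis by (simp add: mult.assoc)
    qed
  qed
  with uI show ?thesis unfolding u_def by (rule semiprime_I)
qed

end

section \<open>The case of characteristic two\<close>

locale centralising_char_two = centralising T I d
  for T I :: "'a::ring set" and d +
  assumes double_mem: "a + a \<in> T"
begin

text \<open>Passing to cosets turns an identity modulo \<open>T\<close> and \<open>2\<close> into one that the simplifier
  decides by cancelling equal monomials in pairs.\<close>

definition cls :: "'a \<Rightarrow> 'a set" where
  "cls a = a +o T"

lemma cls_eq_iff: "cls a = cls b \<longleftrightarrow> a - b \<in> T"
  by (simp add: cls_def coset_eq_iff)

lemma cls_mem: "cls a = cls b \<Longrightarrow> b \<in> T \<Longrightarrow> a \<in> T"
  using add_mem[of "a - b" b] by (simp add: cls_eq_iff)

lemma cls_central: "cls a = cls b \<Longrightarrow> central b \<Longrightarrow> central a"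
  by (simp add: cls_eq_iff central_cong)

lemma cls_add: "cls (a + b) = cls a + cls b"
  by (simp add: cls_def quot_add_coset[OF ideal])

lemma cls_uminus: "cls (- a) = cls a"
proof -
  have "- a - a = - (a + a)" by simp
  then show ?thesis using double_mem[of a] by (simp only: cls_eq_iff uminus_mem)
qed

lemma cls_diff: "cls (a - b) = cls a + cls b"
  using cls_add[of a "- b"] by (simp add: cls_uminus)

text \<open>\<open>cls 0\<close> is \<open>T\<close>, not the neutral element \<open>{0}\<close> of
  set addition, so it stays after a cancellation until \<open>cls_zero\<close> absorbs it.\<close>

lemma cls_cancel: "cls a + cls a = cls 0" "cls a + (cls a + X) = cls 0 + X"
proof -
  show *: "cls a + cls a = cls 0"
    using double_mem[of a] by (simp add: cls_add[symmetric] cls_eq_iff)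
  show "cls a + (cls a + X) = cls 0 + X" by (simp add: * add.assoc[symmetric])
qed

lemma cls_zero:
  "cls 0 + cls a = cls a" "cls a + cls 0 = cls a"
  "cls 0 + (cls a + X) = cls a + X" "cls a + (cls 0 + X) = cls a + X"
proof -
  show *: "cls 0 + cls a = cls a" "cls a + cls 0 = cls a"
    by (simp_all add: cls_add[symmetric])
  show "cls 0 + (cls a + X) = cls a + X" "cls a + (cls 0 + X) = cls a + X"
    by (simp_all add: * add.assoc[symmetric])
qed

lemmas cls_simps = commutator_def d_simps distrib_left distrib_right
  left_diff_distrib right_diff_distrib mult.assoc
  cls_add cls_diff cls_uminus cls_cancel cls_zero add.assoc add.commute add.left_commute

section \<open>Derivatives of elements of \<open>T \<inter> I\<close>\<close>

text \<open>Modulo \<open>T\<close>, the double commutators at \<open>x + t\<close> and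
  \<open>x\<close> differ by \<open>[[d t, x], x]\<close>, which is \<open>k = [d t, x^2]\<close> in
  characteristic 2; so \<open>k\<close> is central. Taking \<open>t x^2\<close> for \<open>t\<close>
  makes \<open>k x^2\<close> central too, and bracketing with \<open>d t\<close> gives
  \<open>k^2\<close> in \<open>T\<close>.\<close>

lemma derivation_square_commutator_mem:
  assumes t: "t \<in> T" "t \<in> I" and x: "x \<in> I"
  shows "\<langle>d t, x * x\<rangle> \<in> T"
proof -
  have central: "central \<langle>d t, x * x\<rangle>" if t: "t \<in> T" "t \<in> I" for t
  proof -
    define E where "E = \<langle>\<langle>d x, t\<rangle>, x + t\<rangle> + \<langle>\<langle>d x, x\<rangle>, t\<rangle> + \<langle>\<langle>d t, t\<rangle>, x + t\<rangle> + \<langle>\<langle>d t, x\<rangle>, t\<rangle>"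
    have "cls \<langle>d t, x * x\<rangle> = cls (\<langle>\<langle>d (x + t), x + t\<rangle>, x + t\<rangle> - \<langle>\<langle>d x, x\<rangle>, x\<rangle> - E)"
      by (simp add: E_def cls_simps)
    moreover have "central E" using t by (intro mem_central) (simp add: E_def)
    ultimately show ?thesis using t x centralising by (auto intro: cls_central)
  qed
  define q where "q = x * x"
  define k where "k = \<langle>d t, q\<rangle>"
  have k: "central k" using central[OF t] by (simp add: k_def q_def)
  have "central (k * q)"
  proof (rule central_cong)
    show "central \<langle>d (t * q), q\<rangle>" using central[of "t * q"] t by (simp add: q_def)
    have "k * q - \<langle>d (t * q), q\<rangle> = - \<langle>t * d q, q\<rangle>"
      by (simp add: k_def commutator_def d_simps algebra_simps)
    then show "k * q - \<langle>d (t * q), q\<rangle> \<in> T" using t by simp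
  qed
  moreover have "k * k = - \<langle>k * q, d t\<rangle> + \<langle>k, d t\<rangle> * q"
    by (simp add: k_def commutator_def algebra_simps)
  ultimately have "k * k \<in> T" using k by simp
  with k show ?thesis unfolding k_def q_def by (rule central_square)
qed

text \<open>Taking \<open>t r\<close> for \<open>t\<close> and linearising \<open>x^2\<close> puts
  \<open>d t [r, x y + y x]\<close> in \<open>T\<close>. Passing from \<open>y\<close> to
  \<open>y x\<close> yields \<open>d t (x y + y x) [r, x]\<close>, where \<open>x y + y x\<close> is
  \<open>[y, x]\<close> in characteristic 2.\<close>

lemma derivation_commutator_mem_I:
  assumes t: "t \<in> T" "t \<in> I" and x: "x \<in> I" and y: "y \<in> I"
  shows "d t * \<langle>y, x\<rangle> \<in> T"
proof -
  have square: "d t * \<langle>r, x * x\<rangle> \<in> T" if x: "x \<in> I" for r x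
  proof -
    have "d t * \<langle>r, x * x\<rangle> = \<langle>d (t * r), x * x\<rangle> - \<langle>t * d r, x * x\<rangle> - \<langle>d t, x * x\<rangle> * r"
      by (simp add: commutator_def d_simps algebra_simps)
    then show ?thesis
      using derivation_square_commutator_mem[of _ x] t x by simp
  qed
  have linear: "d t * \<langle>r, x * z + z * x\<rangle> \<in> T" if "z \<in> I" for r z
  proof -
    have "d t * \<langle>r, x * z + z * x\<rangle>
        = d t * \<langle>r, (x + z) * (x + z)\<rangle> - d t * \<langle>r, x * x\<rangle> - d t * \<langle>r, z * z\<rangle>"
      by (simp add: commutator_def algebra_simps)
    then show ?thesis using square[of "x + z" r] square[of x r] square[of z r] x that by simp
  qed
  define a where "a = d t * \<langle>y, x\<rangle>"
  have product: "a * \<langle>r, x\<rangle> \<in> T" for r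
  proof (rule cls_mem)
    show "cls (a * \<langle>r, x\<rangle>)
        = cls (d t * \<langle>r, x * (y * x) + (y * x) * x\<rangle> - d t * \<langle>r, x * y + y * x\<rangle> * x)"
      by (simp add: a_def cls_simps)
    show "d t * \<langle>r, x * (y * x) + (y * x) * x\<rangle> - d t * \<langle>r, x * y + y * x\<rangle> * x \<in> T"
      using linear[of "y * x" r] linear[of y r] x y by simp
  qed
  have "a * r * a \<in> T" for r
  proof -
    have "a * r * a = a * \<langle>r * d t * y, x\<rangle> - a * \<langle>r * d t, x\<rangle> * y"
      by (simp add: a_def commutator_def algebra_simps)
    then show ?thesis using product by simp
  qed
  then show ?thesis unfolding a_def by (rule semiprimeD)
qed

text \<open>A substitute for \<open>d(T) \<subseteq> T\<close>, which need not hold. Replacing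
  \<open>t\<close> by \<open>t y\<close> frees \<open>y\<close> from \<open>I\<close>, and replacing
  it by \<open>t r\<close> inserts \<open>r\<close>.\<close>

lemma derivation_mult_commutator_mem:
  assumes t: "t \<in> T" "t \<in> I" and x: "x \<in> I"
  shows "d t * r * \<langle>y, x\<rangle> \<in> T"
proof -
  have *: "d t * \<langle>y, x\<rangle> \<in> T" if t: "t \<in> T" "t \<in> I" for t y
  proof (rule semiprime_I)
    let ?a = "d t * \<langle>y, x\<rangle>"
    show "?a \<in> I" using x by simp
    fix i assume i: "i \<in> I"
    have "?a * i = d t * \<langle>y * i, x\<rangle> - d (t * y) * \<langle>i, x\<rangle> + t * d y * \<langle>i, x\<rangle>"
      by (simp add: commutator_def d_simps algebra_simps)
    then have "?a * i \<in> T"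
      using derivation_commutator_mem_I[of t x "y * i"] derivation_commutator_mem_I[of "t * y" x i]
        t x i by simp
    then show "?a * i * ?a \<in> T" by simp
  qed
  have "d t * r * \<langle>y, x\<rangle> = d (t * r) * \<langle>y, x\<rangle> - t * d r * \<langle>y, x\<rangle>"
    by (simp add: d_simps algebra_simps)
  then show ?thesis using *[of "t * r" y] t by simp
qed

section \<open>Linearisation in characteristic two\<close>

text \<open>Modulo 2, \<open>x - y\<close> and \<open>x + y\<close> agree, so signs cannot separate
  degrees; the cubic map is fully polarised by inclusion-exclusion instead.\<close>

lemma trilinear_eq:
  "\<langle>\<langle>d x, y\<rangle>, z\<rangle> + \<langle>\<langle>d x, z\<rangle>, y\<rangle> + \<langle>\<langle>d y, x\<rangle>, z\<rangle> + \<langle>\<langle>d y, z\<rangle>, x\<rangle> + \<langle>\<langle>d z, x\<rangle>, y\<rangle> + \<langle>\<langle>d z, y\<rangle>, x\<rangle>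
     = \<langle>\<langle>d (x + y + z), x + y + z\<rangle>, x + y + z\<rangle>
       - \<langle>\<langle>d (x + y), x + y\<rangle>, x + y\<rangle> - \<langle>\<langle>d (x + z), x + z\<rangle>, x + z\<rangle> - \<langle>\<langle>d (y + z), y + z\<rangle>, y + z\<rangle>
       + \<langle>\<langle>d x, x\<rangle>, x\<rangle> + \<langle>\<langle>d y, y\<rangle>, y\<rangle> + \<langle>\<langle>d z, z\<rangle>, z\<rangle>"
  by (simp add: commutator_def d_simps algebra_simps)

text \<open>The trilinear form at \<open>(x, y, x^2)\<close>, up to \<open>T\<close>. Its two terms
  with \<open>d y\<close> cancel in characteristic 2 because \<open>x\<close> and \<open>x^2\<close>
  commute.\<close>

definition polar :: "'a \<Rightarrow> 'a \<Rightarrow> 'a" where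
  "polar x y = \<langle>d x, \<langle>\<langle>y, x\<rangle>, x\<rangle>\<rangle> + \<langle>\<langle>d x, x\<rangle>, \<langle>y, x\<rangle>\<rangle>"

lemma polar_trilinear:
  fixes x y :: 'a
  defines "z \<equiv> x * x"
  shows "cls (polar x y) = cls (\<langle>\<langle>d x, y\<rangle>, z\<rangle> + \<langle>\<langle>d x, z\<rangle>, y\<rangle> + \<langle>\<langle>d y, x\<rangle>, z\<rangle> + \<langle>\<langle>d y, z\<rangle>, x\<rangle>
    + \<langle>\<langle>d z, x\<rangle>, y\<rangle> + \<langle>\<langle>d z, y\<rangle>, x\<rangle>)"
  by (simp add: polar_def z_def cls_simps)

lemma polar_central:
  assumes "x \<in> I" "y \<in> I"
  shows "central (polar x y)"
  by (rule cls_central[OF polar_trilinear], unfold trilinear_eq)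
    (use assms in \<open>simp add: centralising\<close>)

lemma polar_mult_right:
  "polar x (y * x) = polar x y * x + \<langle>\<langle>y, x\<rangle>, x\<rangle> * \<langle>d x, x\<rangle> + \<langle>y, x\<rangle> * \<langle>\<langle>d x, x\<rangle>, x\<rangle>"
  by (simp add: polar_def commutator_def algebra_simps)

text \<open>With \<open>f\<close> the double commutator, bracketing \<open>polar x (y x)\<close>
  with \<open>x\<close> produces \<open>[[y, x], x] f\<close> twice, which cancels.\<close>

lemma triple_commutator_mult_mem:
  assumes x: "x \<in> I" and y: "y \<in> I"
  shows "\<langle>\<langle>\<langle>y, x\<rangle>, x\<rangle>, x\<rangle> * \<langle>d x, x\<rangle> \<in> T"
proof -
  define u where "u = \<langle>d x, x\<rangle>"
  define f where "f = \<langle>u, x\<rangle>"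
  define p where "p = polar x y"
  define q where "q = polar x (y * x)"
  have c: "central p" "central q" "central f"
    using x y by (simp_all add: p_def q_def f_def u_def polar_central centralising)
  have q: "q = p * x + \<langle>\<langle>y, x\<rangle>, x\<rangle> * u + \<langle>y, x\<rangle> * f"
    by (simp add: q_def p_def f_def u_def polar_mult_right)
  have "cls (\<langle>\<langle>\<langle>y, x\<rangle>, x\<rangle>, x\<rangle> * u) = cls (\<langle>q, x\<rangle> - \<langle>p, x\<rangle> * x - \<langle>y, x\<rangle> * \<langle>f, x\<rangle>)"
    unfolding q by (simp add: f_def cls_simps)
  then show ?thesis unfolding u_def[symmetric] by (rule cls_mem) (use c in simp)
qed

section \<open>Vanishing of the double commutator\<close>

text \<open>Modulo \<open>T\<close>, \<open>x\<close> is an eigenvector of bracketing with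
  \<open>s\<close>, with central eigenvalue \<open>- v\<close>.\<close>

lemma iterated_commutator:
  assumes v: "central v" and s: "\<langle>x, s\<rangle> = - (v * x)"
  shows "\<langle>\<langle>x, s\<rangle>, s\<rangle> - v * v * x \<in> T" "\<langle>\<langle>\<langle>x, s\<rangle>, s\<rangle>, s\<rangle> + v * (v * v) * x \<in> T"
proof -
  have 1: "\<langle>- (v * x), s\<rangle> = - (v * \<langle>x, s\<rangle> + \<langle>v, s\<rangle> * x)"
    by (simp add: commutator_def algebra_simps)
  have 2: "\<langle>\<langle>x, s\<rangle>, s\<rangle> = v * v * x - \<langle>v, s\<rangle> * x"
    unfolding s 1 by (simp add: mult.assoc)
  show "\<langle>\<langle>x, s\<rangle>, s\<rangle> - v * v * x \<in> T" unfolding 2 using v by simp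
  have "\<langle>\<langle>\<langle>x, s\<rangle>, s\<rangle>, s\<rangle> = v * v * \<langle>x, s\<rangle> + \<langle>v * v, s\<rangle> * x - \<langle>\<langle>v, s\<rangle> * x, s\<rangle>"
    unfolding 2 by (simp add: commutator_def algebra_simps)
  then have "\<langle>\<langle>\<langle>x, s\<rangle>, s\<rangle>, s\<rangle> + v * (v * v) * x = \<langle>v * v, s\<rangle> * x - \<langle>\<langle>v, s\<rangle> * x, s\<rangle>"
    unfolding s by (simp add: mult.assoc)
  then show "\<langle>\<langle>\<langle>x, s\<rangle>, s\<rangle>, s\<rangle> + v * (v * v) * x \<in> T" using v by simp
qed

text \<open>The commutators at \<open>s + x\<close> and \<open>s\<close> differ by \<open>Y\<close>,
  so \<open>k x Y\<close> is in \<open>T\<close>; bracketing with \<open>x\<close> leaves the claim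
  and a term with \<open>d [v, x]\<close>.\<close>

lemma polarised_commutator_mem:
  fixes a x l :: 'a
  defines "v \<equiv> \<langle>a, x\<rangle>" and "s \<equiv> a * x"
  defines "k \<equiv> v * l"
  assumes x: "x \<in> I" and v: "central v" and k: "central k"
    and s_mem: "k * x * \<langle>d s, s\<rangle> \<in> T" and sx_mem: "k * x * \<langle>d (s + x), s + x\<rangle> \<in> T"
  shows "k * (x * (\<langle>\<langle>d x, x\<rangle>, x\<rangle> + v * \<langle>d x, x\<rangle>)) \<in> T"
proof -
  define Y where "Y = \<langle>d x, x\<rangle> + d v * x + v * d x"
  have "cls Y = cls (\<langle>d (s + x), s + x\<rangle> - \<langle>d s, s\<rangle>)"
    by (simp add: Y_def s_def v_def cls_simps)
  then have "Y - (\<langle>d (s + x), s + x\<rangle> - \<langle>d s, s\<rangle>) \<in> T" by (simp add: cls_eq_iff)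
  moreover have "k * (x * Y) = k * x * (Y - (\<langle>d (s + x), s + x\<rangle> - \<langle>d s, s\<rangle>))
      + k * x * \<langle>d (s + x), s + x\<rangle> - k * x * \<langle>d s, s\<rangle>"
    by (simp add: algebra_simps)
  ultimately have "k * (x * Y) \<in> T" using s_mem sx_mem by simp
  then have Y: "k * \<langle>x * Y, x\<rangle> \<in> T" using k by (intro central_mult_commutator)
  \<comment> \<open>\<open>[v, x]\<close> is in \<open>T \<inter> I\<close>, but its derivative may
    leave \<open>T\<close>. The factor \<open>v\<close> of \<open>k\<close> is itself a bracket with
    \<open>x\<close> and kills it.\<close>
  have "d \<langle>v, x\<rangle> * x * v \<in> T"
    unfolding v_def by (rule derivation_mult_commutator_mem) (use v x in \<open>auto simp: v_def\<close>)
  then have "x * (d \<langle>v, x\<rangle> * x * v) * l \<in> T" by simp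
  also have "x * (d \<langle>v, x\<rangle> * x * v) * l = x * (d \<langle>v, x\<rangle> * x) * k"
    by (simp only: k_def mult.assoc)
  finally have j: "k * (x * (d \<langle>v, x\<rangle> * x)) \<in> T" by (rule central_commute_mem[OF k])
  have "k * (x * (\<langle>\<langle>d x, x\<rangle>, x\<rangle> + v * \<langle>d x, x\<rangle>))
      = k * \<langle>x * Y, x\<rangle> - k * (x * (d \<langle>v, x\<rangle> * x)) + k * (x * (\<langle>v, d x\<rangle> * x)) - k * (x * (\<langle>v, x\<rangle> * d x))"
    by (simp add: Y_def commutator_def d_simps algebra_simps)
  then show ?thesis using Y j v by simp
qed

lemma double_commutator_mem:
  assumes x: "x \<in> I"
  shows "\<langle>\<langle>d x, x\<rangle>, x\<rangle> \<in> T"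
proof -
  define u where "u = \<langle>d x, x\<rangle>"
  define c where "c = \<langle>u, x\<rangle>"
  define k where "k = c * (c * c)"
  have c: "central c" using x by (simp add: c_def u_def centralising)
  then have k: "central k" by (simp add: k_def)
  \<comment> \<open>The triple-commutator identity at \<open>r\<close> in direction
    \<open>x\<close>, to be used for \<open>u x\<close> and \<open>u x + x\<close>.\<close>
  have mem: "k * x * \<langle>d r, r\<rangle> \<in> T" if "r \<in> I" "\<langle>x, r\<rangle> = - (c * x)" for r
  proof -
    have "k * x * \<langle>d r, r\<rangle> = (\<langle>\<langle>\<langle>x, r\<rangle>, r\<rangle>, r\<rangle> + k * x) * \<langle>d r, r\<rangle> - \<langle>\<langle>\<langle>x, r\<rangle>, r\<rangle>, r\<rangle> * \<langle>d r, r\<rangle>"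
      by (simp add: distrib_right)
    then show ?thesis
      using iterated_commutator(2)[OF c that(2)] triple_commutator_mult_mem[OF that(1) x]
      by (simp add: k_def)
  qed
  have "\<langle>x, u * x\<rangle> = - (c * x)" "\<langle>x, u * x + x\<rangle> = - (c * x)"
    by (simp_all add: c_def commutator_def algebra_simps)
  then have "k * (x * (c + c * u)) \<in> T"
    using polarised_commutator_mem[of x u "c * c", folded u_def, folded c_def, folded k_def] mem x c k
    by simp
  \<comment> \<open>Bracketing with \<open>x\<close> discards the summand \<open>c\<close> and turns
    \<open>u\<close> into \<open>c\<close>; bracketing with \<open>u\<close> below turns
    \<open>x\<close> into \<open>- c\<close>.\<close>
  then have "k * \<langle>x * (c + c * u), x\<rangle> \<in> T" using k by (intro central_mult_commutator)
  moreover have "k * (x * (c * c))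
      = k * \<langle>x * (c + c * u), x\<rangle> - k * (x * \<langle>c, x\<rangle>) - k * (x * (\<langle>c, x\<rangle> * u))"
    by (simp add: c_def commutator_def algebra_simps)
  ultimately have "k * (x * (c * c)) \<in> T" using c by simp
  then have "k * \<langle>x * (c * c), u\<rangle> \<in> T" using k by (intro central_mult_commutator)
  moreover have "k * k = k * (x * \<langle>c * c, u\<rangle>) - k * \<langle>x * (c * c), u\<rangle>"
  proof -
    have "\<langle>x * (c * c), u\<rangle> = x * \<langle>c * c, u\<rangle> - c * (c * c)"
      by (subst (5) c_def) (simp add: commutator_def algebra_simps)
    then show ?thesis by (simp add: k_def right_diff_distrib)
  qed
  ultimately have "k * k \<in> T" using c by simp
  with k have "k \<in> T" by (rule central_square)
  then have "c * c * (c * c) \<in> T" using mult_left_mem[of k c] by (simp add: k_def mult.assoc)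
  then show ?thesis using c by (metis central_square central_mult c_def u_def)
qed

section \<open>Vanishing of the commutator\<close>

text \<open>Double commutators are now in \<open>T\<close>, so \<open>polar\<close> is in
  \<open>T\<close> and not merely central: one bracket fewer is needed than in
  \<open>triple_commutator_mult_mem\<close>.\<close>

lemma double_commutator_mult_mem:
  assumes x: "x \<in> I" and y: "y \<in> I"
  shows "\<langle>\<langle>y, x\<rangle>, x\<rangle> * \<langle>d x, x\<rangle> \<in> T"
proof -
  have polar: "polar x y \<in> T" if "y \<in> I" for y
    by (rule cls_mem[OF polar_trilinear], unfold trilinear_eq)
      (use x that in \<open>simp add: double_commutator_mem\<close>)
  have "\<langle>\<langle>y, x\<rangle>, x\<rangle> * \<langle>d x, x\<rangle> = polar x (y * x) - polar x y * x - \<langle>y, x\<rangle> * \<langle>\<langle>d x, x\<rangle>, x\<rangle>"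
    unfolding polar_mult_right by simp
  then show ?thesis using polar[of y] polar[of "y * x"] y x double_commutator_mem[of x] by simp
qed

text \<open>In characteristic 2, \<open>[[y, x], x]\<close> equals \<open>[y, x^2]\<close>, a
  derivation in \<open>y\<close>. Its product rule first inserts \<open>r\<close> and then frees
  \<open>y\<close> from \<open>I\<close>; semiprimeness frees \<open>r\<close>.\<close>

lemma commutator_square_mult_mem:
  assumes x: "x \<in> I"
  shows "\<langle>y, x * x\<rangle> * r * \<langle>d x, x\<rangle> \<in> T"
proof -
  define u where "u = \<langle>d x, x\<rangle>"
  define q where "q = x * x"
  have uI: "u \<in> I" using x by (simp add: u_def)
  have 1: "\<langle>y, q\<rangle> * u \<in> T" if y: "y \<in> I" for y
  proof (rule cls_mem)
    show "cls (\<langle>y, q\<rangle> * u) = cls (\<langle>\<langle>y, x\<rangle>, x\<rangle> * u)"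
      by (simp add: q_def cls_simps)
    show "\<langle>\<langle>y, x\<rangle>, x\<rangle> * u \<in> T"
      unfolding u_def using x y by (rule double_commutator_mult_mem)
  qed
  have 2: "\<langle>y, q\<rangle> * r * u \<in> T" if "y \<in> I" "r \<in> I" for y r
  proof -
    have "\<langle>y, q\<rangle> * r * u = \<langle>y * r, q\<rangle> * u - y * (\<langle>r, q\<rangle> * u)"
      by (simp add: commutator_def algebra_simps)
    then show ?thesis using 1[of "y * r"] 1[of r] that by simp
  qed
  have 3: "\<langle>y, q\<rangle> * i * r * u \<in> T" if "i \<in> I" "r \<in> I" for i r
  proof -
    have "\<langle>y, q\<rangle> * i * r * u = \<langle>y * i, q\<rangle> * r * u - y * (\<langle>i, q\<rangle> * r * u)"
      by (simp add: commutator_def algebra_simps)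
    then show ?thesis using 2[of "y * i" r] 2[of i r] that by simp
  qed
  have "\<langle>y, q\<rangle> * r * u \<in> T"
  proof (rule semiprime_I)
    show "\<langle>y, q\<rangle> * r * u \<in> I" using uI by simp
    fix z assume z: "z \<in> I"
    have "\<langle>y, q\<rangle> * (r * u) * (z * \<langle>y, q\<rangle> * r) * u \<in> T"
      by (rule 3) (use uI z in simp_all)
    then show "\<langle>y, q\<rangle> * r * u * z * (\<langle>y, q\<rangle> * r * u) \<in> T" by (simp add: mult.assoc)
  qed
  then show ?thesis by (simp add: u_def q_def)
qed

text \<open>In characteristic 2, \<open>[d x, x] = d (x^2)\<close>, so differentiating
  \<open>[x^2, r] y u\<close> brings out \<open>[u, r] y u\<close>.\<close>

lemma commutator_central:
  assumes x: "x \<in> I"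
  shows "central \<langle>d x, x\<rangle>"
  unfolding central_def
proof
  fix r
  define u where "u = \<langle>d x, x\<rangle>"
  define q where "q = x * x"
  define A where "A = \<langle>u, r\<rangle>"
  have uI: "u \<in> I" using x by (simp add: u_def)
  have q: "\<langle>y, q\<rangle> * r * u \<in> T" for y r
    using commutator_square_mult_mem[OF x] by (simp add: u_def q_def)
  have q': "\<langle>q, y\<rangle> * r * u \<in> T" for y r
  proof -
    have "\<langle>q, y\<rangle> * r * u = - (\<langle>y, q\<rangle> * r * u)" by (simp add: commutator_def algebra_simps)
    then show ?thesis using q by simp
  qed
  have 1: "A * y * u * s * u \<in> T" for y s
  proof (rule cls_mem)
    \<comment> \<open>\<open>t\<close> is in \<open>T \<inter> I\<close>, and \<open>d t s u\<close>
      is in \<open>T\<close> because \<open>u\<close> is itself a bracket with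
      \<open>x\<close>.\<close>
    define t where "t = \<langle>q, r\<rangle> * y * u"
    have t: "d t * s * u \<in> T" unfolding u_def
      by (rule derivation_mult_commutator_mem) (use q' uI x in \<open>simp_all add: t_def\<close>)
    let ?b = "d t * s * u - \<langle>q, d r\<rangle> * y * u * (s * u) - \<langle>q, r\<rangle> * d y * u * (s * u)
      - \<langle>q, r\<rangle> * (y * d u * s) * u"
    show "cls (A * y * u * s * u) = cls ?b"
      by (simp add: A_def t_def q_def u_def cls_simps)
    show "?b \<in> T" using t q' by simp
  qed
  have 2: "A * y * u \<in> T" for y
  proof (rule semiprimeD)
    show "A * y * u * z * (A * y * u) \<in> T" for z
      using 1[of y "z * A * y"] by (simp add: mult.assoc)
  qed
  have "A * y * A \<in> T" for y
  proof -
    have "A * y * A = A * y * u * r - A * (y * r) * u"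
      by (simp add: A_def commutator_def algebra_simps)
    then show ?thesis using 2 by simp
  qed
  then have "A \<in> T" by (rule semiprimeD)
  then show "\<langle>\<langle>d x, x\<rangle>, r\<rangle> \<in> T" by (simp add: A_def u_def)
qed

theorem commuting:
  assumes x: "x \<in> I"
  shows "\<langle>d x, x\<rangle> \<in> T"
proof -
  define u where "u = \<langle>d x, x\<rangle>"
  define k where "k = u * u"
  have u: "central u" using x by (simp add: u_def commutator_central)
  then have k: "central k" by (simp add: k_def)
  have mem: "k * x * \<langle>d r, r\<rangle> \<in> T" if r: "r \<in> I" "\<langle>x, r\<rangle> = - (u * x)" for r
  proof -
    have "k * x * \<langle>d r, r\<rangle> = \<langle>\<langle>x, r\<rangle>, r\<rangle> * \<langle>d r, r\<rangle> - (\<langle>\<langle>x, r\<rangle>, r\<rangle> - k * x) * \<langle>d r, r\<rangle>"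
      by (simp add: left_diff_distrib)
    then show ?thesis
      using iterated_commutator(1)[OF u r(2)] double_commutator_mult_mem[OF r(1) x]
      by (simp add: k_def)
  qed
  have "\<langle>x, d x * x\<rangle> = - (u * x)" "\<langle>x, d x * x + x\<rangle> = - (u * x)"
    by (simp_all add: u_def commutator_def algebra_simps)
  then have "k * (x * (\<langle>u, x\<rangle> + u * u)) \<in> T"
    using polarised_commutator_mem[of x "d x" u, folded u_def, folded k_def] mem x u k by (simp flip: k_def)
  moreover have "k * (x * (u * u)) = k * (x * (\<langle>u, x\<rangle> + u * u)) - k * (x * \<langle>u, x\<rangle>)"
    by (simp add: algebra_simps)
  ultimately have "k * (x * (u * u)) \<in> T" using u by simp
  \<comment> \<open>As \<open>u\<close> is central by now, \<open>d x\<close> serves as the element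
    whose bracket with \<open>x\<close> yields a central factor.\<close>
  then have "k * \<langle>x * (u * u), d x\<rangle> \<in> T" using k by (intro central_mult_commutator)
  moreover have "k * (u * (u * u)) = k * (x * \<langle>u * u, d x\<rangle>) - k * \<langle>x * (u * u), d x\<rangle>"
  proof -
    have "\<langle>x * (u * u), d x\<rangle> = x * \<langle>u * u, d x\<rangle> - u * (u * u)"
      by (subst (5) u_def) (simp add: commutator_def algebra_simps)
    then show ?thesis by (simp add: right_diff_distrib)
  qed
  ultimately have "k * (u * (u * u)) \<in> T" using u by simp
  \<comment> \<open>From \<open>u^5\<close> one passes to \<open>u^6 = (u^3)^2\<close>, then to
    \<open>u^3\<close>, \<open>u^4 = (u^2)^2\<close> and finally \<open>u\<close>.\<close>
  then have "u * k * (u * k) \<in> T" using mult_left_mem[of "k * (u * (u * u))" u]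
    by (simp add: k_def mult.assoc)
  then have "u * k \<in> T" by (rule central_square[OF central_mult[OF u k]])
  then have "k * k \<in> T" using mult_left_mem[of "u * k" u] by (simp add: k_def mult.assoc)
  with u k show ?thesis by (metis central_square k_def u_def)
qed

end

section \<open>Splitting along the 2-torsion\<close>

lemma semiprime_two_torsion:
  assumes "semiprime_ideal T"
  shows "semiprime_ideal {a. a + a \<in> T}"
proof -
  interpret semiprime T using assms by unfold_locales
  show ?thesis
    unfolding semiprime_ideal_def two_sided_ideal_def mem_Collect_eq
  proof (intro conjI ballI allI impI, unfold mem_Collect_eq)
    fix x y assume "x + x \<in> T" "y + y \<in> T"
    moreover have "x - y + (x - y) = (x + x) - (y + y)" by simp
    ultimately show "x - y + (x - y) \<in> T" by (simp only: diff_mem)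
  next
    fix a assume *: "\<forall>r. a * r * a + a * r * a \<in> T"
    show "a + a \<in> T"
    proof (rule semiprimeD)
      show "(a + a) * r * (a + a) \<in> T" for r
        using * by (simp add: distrib_left distrib_right)
    qed
  next
    fix r x assume x: "x + x \<in> T"
    have "r * x + r * x = r * (x + x)" "x * r + x * r = (x + x) * r"
      by (simp_all only: distrib_left distrib_right)
    then show "r * x + r * x \<in> T" "x * r + x * r \<in> T"
      using x by (simp_all only: mult_left_mem mult_right_mem)
  qed simp
qed

text \<open>Semiprimeness rests on \<open>(a t) r (a t) = (a (t r) a) t\<close>.\<close>

lemma semiprime_annihilator:
  assumes "semiprime_ideal T" and J: "two_sided_ideal J"
  shows "semiprime_ideal {a. \<forall>t\<in>J. a * t \<in> T}"
proof -
  interpret semiprime T using assms by unfold_locales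
  have J_mult: "r * t \<in> J" if "t \<in> J" for r t
    using J that by (simp add: two_sided_ideal_def)
  show ?thesis
    unfolding semiprime_ideal_def two_sided_ideal_def mem_Collect_eq
  proof (intro conjI ballI allI impI, unfold mem_Collect_eq)
    fix a t assume *: "\<forall>r. \<forall>t\<in>J. a * r * a * t \<in> T" and t: "t \<in> J"
    show "a * t \<in> T"
    proof (rule semiprimeD)
      show "a * t * r * (a * t) \<in> T" for r
        using *[rule_format, OF t, of "t * r"] by (simp add: mult.assoc)
    qed
  qed (auto simp: left_diff_distrib mult.assoc J_mult)
qed

theorem theorem2p5:
  fixes I T :: "'a::ring set" and d :: "'a \<Rightarrow> 'a"
  assumes "two_sided_ideal I" and "I \<noteq> {0}"
    and "semiprime_ideal T" and "T \<subset> I"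
    and "derivation d"
    and "quot_char T \<noteq> 2"
    and "\<forall>x\<in>I. commutator (commutator (d x) x) x +o T \<in> quot_center T"
  shows "T_commuting_on T d I"
  unfolding T_commuting_on_def
proof
  fix x assume x: "x \<in> I"
  interpret semiprime T using assms(3) by unfold_locales
  define J where "J = {a. a + a \<in> T}"
  define K where "K = {a. \<forall>t\<in>J. a * t \<in> T}"
  have central: "\<langle>\<langle>\<langle>d y, y\<rangle>, y\<rangle>, r\<rangle> \<in> T" if "y \<in> I" for y r
    using assms(7) that
    by (simp add: coset_in_quot_center_iff[OF ideal] coset_eq_iff commutator_def)
  have J: "semiprime_ideal J" unfolding J_def by (rule semiprime_two_torsion[OF assms(3)])
  then have "two_sided_ideal J" by (simp add: semiprime_ideal_def)
  then have K: "semiprime_ideal K" unfolding K_def by (rule semiprime_annihilator[OF assms(3)])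
  have sub: "T \<subseteq> J" "T \<subseteq> K" by (auto simp: J_def K_def)
  interpret J: semiprime J using J by unfold_locales
  interpret K: semiprime K using K by unfold_locales
  have "\<langle>d x, x\<rangle> \<in> J"
  proof (rule centralising_torsion_free.commuting[OF _ x])
    show "centralising_torsion_free J I d"
    proof
      show "J.central \<langle>\<langle>d y, y\<rangle>, y\<rangle>" if "y \<in> I" for y
        using central[OF that] sub by (auto simp: J.central_def)
      fix a assume "a + a \<in> J"
      then have "a + a + (a + a) \<in> T" by (simp add: J_def)
      moreover have "(a + a) * r * (a + a) = a * r * (a + a + (a + a))" for r
        by (simp add: algebra_simps)
      ultimately have "(a + a) * r * (a + a) \<in> T" for r
        by (simp only: mult_left_mem)
      then show "a \<in> J" unfolding J_def mem_Collect_eq by (rule semiprimeD)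
    qed (use assms in simp_all)
  qed
  moreover have "\<langle>d x, x\<rangle> \<in> K"
  proof (rule centralising_char_two.commuting[OF _ x])
    show "centralising_char_two K I d"
    proof
      show "K.central \<langle>\<langle>d y, y\<rangle>, y\<rangle>" if "y \<in> I" for y
        using central[OF that] sub by (auto simp: K.central_def)
      have "(a + a) * t = a * (t + t)" for a t :: 'a by (simp add: algebra_simps)
      then have "(a + a) * t \<in> T" if "t \<in> J" for a t using that by (simp add: J_def)
      then show "a + a \<in> K" for a by (simp add: K_def)
    qed (use assms in simp_all)
  qed
  \<comment> \<open>\<open>r [d x, x]\<close> is in \<open>J\<close>, and the left factor, being in
    \<open>K\<close>, annihilates \<open>J\<close>.\<close>
  ultimately have "\<langle>d x, x\<rangle> * r * \<langle>d x, x\<rangle> \<in> T" for r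
    by (simp add: K_def mult.assoc)
  then show "\<langle>d x, x\<rangle> \<in> T" by (rule semiprimeD)
qed

end
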